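(* Let $m$ be a positive integer and $q=2^m$. Then the polynomial $f(x)=x^{96q+1}+x^{65q+32}+x^{33q+64}+x^{32q+65}+x^{97}\in\mathbb{F}_{q^2}[x]$ permutes $\mathbb{F}_{q^2}$ if and only if $m\not\equiv 0 \pmod{24}$.
   Context: A polynomial $f\in\mathbb{F}_{q^2}[x]$ permutes $\mathbb{F}_{q^2}$ if the map $a\mapsto f(a)$ is a bijection of $\mathbb{F}_{q^2}$. *)

theory Defs
  imports "HOL-Computational_Algebra.Computational_Algebra"
    "HOL-Number_Theory.Cong"
    "HOL-Library.Cardinality"
begin

definition permutation_polynomial :: "'a::finite_field poly \<Rightarrow> bool" where
  "permutation_polynomial p \<longleftrightarrow> bij (poly p)"

definition f_poly :: "nat \<Rightarrow> 'a::finite_field poly" where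
  "f_poly q = monom 1 (96 * q + 1) + monom 1 (65 * q + 32) + monom 1 (33 * q + 64)
     + monom 1 (32 * q + 65) + monom 1 97"

end

theory Submission
  imports Defs
begin

text \<open>
  Write \<open>y = x ^ q\<close> and let \<open>\<omega>\<close> be a primitive cube root of unity. Since \<open>\<omega> ^ 32 = \<omega>\<^sup>2\<close>, expanding
  \<open>(y + \<omega> * x) ^ 97 = (y ^ 32 + \<omega>\<^sup>2 * x ^ 32) ^ 3 * (y + \<omega> * x)\<close> shows that
  \<open>f(x) ^ q + \<omega> * f(x) = (x ^ q + \<omega> * x) ^ 97\<close> for both choices of \<open>\<omega>\<close>. The two linearized polynomials
  \<open>x ^ q + \<omega> * x\<close> together separate points, so \<open>f\<close> is injective whenever the 97th power map is.
  If \<open>24\<close> divides \<open>m\<close>, then \<open>\<omega>\<close> is fixed by the \<open>q\<close>-th power map, a single linearized polynomial is already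
  bijective and conjugates \<open>f\<close> to the 97th power map, which is not injective. Finally, \<open>97\<close> divides
  \<open>q\<^sup>2 - 1 = 4 ^ m - 1\<close> if and only if \<open>24\<close> divides \<open>m\<close>.
\<close>

text \<open>Translation by 1 permutes the ring, so it leaves the sum of all elements unchanged;
  comparing the two sums gives \<open>CARD('a) * 1 = 0\<close>.\<close>

lemma CHAR_dvd_CARD: "CHAR('a::{finite, comm_ring_1}) dvd CARD('a)"
proof -
  have "(\<Sum>x\<in>UNIV. x :: 'a) = (\<Sum>x\<in>UNIV. x + 1)"
    by (rule sum.reindex_bij_witness[of _ "\<lambda>x. x + 1" "\<lambda>x. x - 1"]) auto
  hence "(of_nat CARD('a) :: 'a) = 0"
    by (simp add: sum.distrib)
  thus ?thesis
    by (simp add: of_nat_eq_0_iff_char_dvd)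
qed

lemma finite_field_power_card_minus_1:
  fixes x :: "'a::finite_field"
  assumes "x \<noteq> 0"
  shows "x ^ (CARD('a) - 1) = 1"
proof -
  have "x * x ^ (CARD('a) - 1) = x"
    by (metis finite_field_power_card_eq_same power_eq_if zero_less_card_finite less_irrefl)
  thus ?thesis using assms by simp
qed

text \<open>Bezout yields an inverse \<open>k\<close> of \<open>n\<close> modulo the order of the
  multiplicative group, and the \<open>k\<close>-th power then undoes the \<open>n\<close>-th
  power.\<close>

lemma finite_field_inj_power:
  assumes "coprime n (CARD('a) - 1)" "n > 0"
  shows "inj (\<lambda>x::'a::finite_field. x ^ n)"
proof (rule injI)
  fix x y :: 'a
  assume eq: "x ^ n = y ^ n"
  obtain k l where kl: "n * k = (CARD('a) - 1) * l + gcd n (CARD('a) - 1)"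
    using bezout_nat[of n "CARD('a) - 1"] \<open>n > 0\<close> by blast
  have id: "z ^ (n * k) = z" for z :: 'a
  proof (cases "z = 0")
    case True
    \<comment> \<open>Positivity matters at zero because \<open>0 ^ 0 = 1\<close>.\<close>
    have "n * k > 0" using kl \<open>n > 0\<close> by (metis add_gr_0 gcd_pos_nat not_gr_zero)
    with True show ?thesis by (simp only: power_0_left) simp
  next
    case False
    have "z ^ (n * k) = (z ^ (CARD('a) - 1)) ^ l * z"
      unfolding kl by (simp only: power_add power_mult coprime_imp_gcd_eq_1[OF assms(1)] power_one_right)
    also have "\<dots> = z"
      by (simp only: finite_field_power_card_minus_1[OF False] power_one mult_1_left)
    finally show ?thesis .
  qed
  show "x = y"
    using id[of x] id[of y] eq by (simp add: power_mult)
qed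

text \<open>With \<open>CARD('a) - 1 = n * k\<close>, the polynomial \<open>x ^ k - 1\<close> has
  too few roots to vanish at every unit; the \<open>k\<close>-th power of a unit that is not a root
  is the desired element.\<close>

lemma finite_field_ex_root_of_unity:
  assumes "n dvd CARD('a) - 1" "n > 1"
  shows "\<exists>z::'a::finite_field. z \<noteq> 1 \<and> z ^ n = 1"
proof -
  obtain k where k: "CARD('a) - 1 = n * k" using assms by (elim dvdE)
  have "CARD('a) \<ge> 2"
    using card_mono[of UNIV "{0::'a, 1}"] by simp
  hence "k > 0" using k by (cases k) auto
  define p :: "'a poly" where "p = monom 1 k - 1"
  have "coeff p k = 1" using \<open>k > 0\<close> by (simp add: p_def)
  hence "p \<noteq> 0" by auto
  have "degree p \<le> k"
    unfolding p_def by (intro degree_diff_le) (simp_all add: degree_monom_eq)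
  hence "card {x. poly p x = 0} \<le> k"
    using card_poly_roots_bound[OF \<open>p \<noteq> 0\<close>] by simp
  also have "k < n * k" using \<open>k > 0\<close> \<open>n > 1\<close> by simp
  also have "n * k = card (UNIV - {0::'a})"
    using k by (simp add: card_Diff_singleton)
  finally have "\<not> UNIV - {0} \<subseteq> {x. poly p x = 0}"
    by (meson card_mono finite_code leD)
  then obtain a where a: "a \<noteq> 0" "poly p a \<noteq> 0" by auto
  hence "a ^ k \<noteq> 1" by (simp add: p_def poly_monom)
  moreover have "(a ^ k) ^ n = 1"
    using finite_field_power_card_minus_1[OF a(1)] k by (simp add: power_mult mult.commute)
  ultimately show ?thesis by blast
qed

text \<open>The order of 4 modulo 97 is 24: the exponent is reduced modulo 24 and the remaining
  residues are checked one by one.\<close>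

lemma dvd_97_four_power_minus_1_iff: "97 dvd (4 ^ m - 1 :: nat) \<longleftrightarrow> 24 dvd m"
proof -
  have "(4 ^ 24 :: nat) mod 97 = 1" by simp
  hence "[4 ^ 24 = 1::nat] (mod 97)" by (simp add: cong_def)
  hence "[(4 ^ 24) ^ (m div 24) * 4 ^ (m mod 24) = 1 ^ (m div 24) * 4 ^ (m mod 24) :: nat] (mod 97)"
    by (intro cong_mult cong_pow) auto
  hence "[4 ^ m = 4 ^ (m mod 24) :: nat] (mod 97)"
    by (simp only: power_mult[symmetric] power_add[symmetric] mult_div_mod_eq power_one mult_1_left)
  hence "97 dvd (4 ^ m - 1 :: nat) \<longleftrightarrow> (4 ^ (m mod 24) :: nat) mod 97 = 1"
    using cong_altdef_nat[of 1 "4 ^ m :: nat" 97] by (auto simp: cong_def)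
  also have "\<dots> \<longleftrightarrow> m mod 24 = 0"
  proof -
    have "\<forall>r\<in>{..<24::nat}. (4 ^ r :: nat) mod 97 = 1 \<longleftrightarrow> r = 0"
      by (simp add: lessThan_nat_numeral lessThan_Suc)
    thus ?thesis by simp
  qed
  also have "\<dots> \<longleftrightarrow> 24 dvd m" by (simp add: dvd_eq_mod_eq_0)
  finally show ?thesis .
qed

text \<open>The 32nd power is additive in characteristic 2, and \<open>97 = 3 * 32 + 1\<close>. For
  \<open>y = x ^ q\<close> the second bracket is \<open>f(x)\<close>, and exchanging
  \<open>x\<close> and \<open>y\<close> turns it into the first.\<close>

lemma char_2_power_97:
  fixes x y w :: "'a::comm_ring_1"
  assumes char: "CHAR('a) = 2" and w: "w\<^sup>2 + w + 1 = 0"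
  defines "X \<equiv> x ^ 32" and "Y \<equiv> y ^ 32"
  shows "(y + w * x) ^ 97 =
    (Y ^ 3 * y + Y\<^sup>2 * y * X + Y\<^sup>2 * x * X + Y * x * X\<^sup>2 + y * X ^ 3)
      + w * (Y ^ 3 * x + Y\<^sup>2 * y * X + Y * y * X\<^sup>2 + Y * x * X\<^sup>2 + x * X ^ 3)"
proof -
  have two: "(2::'a) = 0"
    using char of_nat_CHAR[where 'a = 'a] by simp
  have "w ^ 3 - 1 = (w - 1) * (w\<^sup>2 + w + 1)"
    by (simp add: power2_eq_square power3_eq_cube algebra_simps)
  hence w3: "w ^ 3 = 1" by (simp add: w)
  have "w\<^sup>2 = - (w + 1)" using w by (simp only: eq_neg_iff_add_eq_0 add.assoc)
  hence w2: "w\<^sup>2 = w + 1" by (simp only: uminus_CHAR_2[OF char])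
  have "w ^ 32 = (w ^ 3) ^ 10 * w\<^sup>2" by (simp flip: power_mult power_add)
  hence w32: "w ^ 32 = w\<^sup>2" by (simp add: w3)
  have "(y + w * x) ^ 97 = ((y + w * x) ^ 32) ^ 3 * (y + w * x)"
    by (simp flip: power_mult power_Suc2)
  also have "(y + w * x) ^ 32 = Y + w\<^sup>2 * X"
    using freshmans_dream'[of 32 5 y "w * x"] char
    by (simp add: X_def Y_def power_mult_distrib w32)
  \<comment> \<open>Each binomial coefficient 3 is split as 1 + 2, so that the doubled part vanishes
    in characteristic 2.\<close>
  also have "(Y + w\<^sup>2 * X) ^ 3 =
      Y ^ 3 + w\<^sup>2 * Y\<^sup>2 * X + w ^ 3 * w * Y * X\<^sup>2 + (w ^ 3)\<^sup>2 * X ^ 3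
        + 2 * (w\<^sup>2 * Y\<^sup>2 * X + w ^ 3 * w * Y * X\<^sup>2)"
    by (simp only: mult_2) (simp add: power2_eq_square power3_eq_cube algebra_simps)
  also have "\<dots> = Y ^ 3 + (w + 1) * Y\<^sup>2 * X + w * Y * X\<^sup>2 + X ^ 3"
    by (simp add: two w3 w2)
  also have "\<dots> * (y + w * x) =
      Y ^ 3 * y + (w + 1) * Y\<^sup>2 * X * y + w * Y * X\<^sup>2 * y + X ^ 3 * y
        + w * Y ^ 3 * x + (w\<^sup>2 + w) * Y\<^sup>2 * X * x + w\<^sup>2 * Y * X\<^sup>2 * x + w * X ^ 3 * x"
    by (simp add: power2_eq_square power3_eq_cube algebra_simps)
  also have "w\<^sup>2 + w = 1"
    using two by (simp add: w2 add.assoc[symmetric] add.commute[of w] flip: mult_2)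
  also have "w\<^sup>2 = w + 1" by (rule w2)
  also have "Y ^ 3 * y + (w + 1) * Y\<^sup>2 * X * y + w * Y * X\<^sup>2 * y + X ^ 3 * y
        + w * Y ^ 3 * x + 1 * Y\<^sup>2 * X * x + (w + 1) * Y * X\<^sup>2 * x + w * X ^ 3 * x =
    (Y ^ 3 * y + Y\<^sup>2 * y * X + Y\<^sup>2 * x * X + Y * x * X\<^sup>2 + y * X ^ 3)
      + w * (Y ^ 3 * x + Y\<^sup>2 * y * X + Y * y * X\<^sup>2 + Y * x * X\<^sup>2 + x * X ^ 3)"
    by (simp add: power2_eq_square power3_eq_cube algebra_simps)
  finally show ?thesis .
qed

lemma poly_f_poly:
  fixes q :: nat and x :: "'a::finite_field"
  defines "y \<equiv> x ^ q"
  shows "poly (f_poly q) x = (y ^ 32) ^ 3 * x + (y ^ 32)\<^sup>2 * y * x ^ 32 + y ^ 32 * y * (x ^ 32)\<^sup>2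
    + y ^ 32 * x * (x ^ 32)\<^sup>2 + x * (x ^ 32) ^ 3"
  by (simp add: f_poly_def poly_monom y_def add.commute mult.commute mult.left_commute
      flip: power_mult power_add power_Suc power_Suc2)

context
  fixes m q :: nat
  assumes q_def: "q = 2 ^ m" and card: "CARD('a::finite_field) = q\<^sup>2"
begin

lemma CHAR_eq_2: "CHAR('a) = 2"
proof -
  have "CHAR('a) dvd 2 ^ (m * 2)"
    using CHAR_dvd_CARD[where 'a = 'a] by (simp add: card q_def power_mult)
  moreover have "prime CHAR('a)"
    by (simp add: prime_CHAR_semidom finite_imp_CHAR_pos)
  ultimately show ?thesis
    by (metis prime_dvd_power primes_dvd_imp_eq two_is_prime_nat)
qed

lemma power_q_add: "(x + y :: 'a) ^ q = x ^ q + y ^ q"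
  by (rule freshmans_dream') (simp_all add: CHAR_eq_2 q_def)

lemma power_q_power_q: "((x :: 'a) ^ q) ^ q = x"
  using finite_field_power_card_eq_same[of x]
  by (simp add: card power2_eq_square flip: power_mult)

lemma power_q_power_commute: "((x :: 'a) ^ n) ^ q = (x ^ q) ^ n"
  by (simp add: mult.commute flip: power_mult)

text \<open>The \<open>q\<close>-th power map is an additive involution, so it exchanges
  \<open>x\<close> and \<open>x ^ q\<close> inside \<open>f\<close>; this matches the two brackets
  of \<open>char_2_power_97\<close>.\<close>

lemma linearized_f_poly:
  fixes w :: 'a
  assumes "w\<^sup>2 + w + 1 = 0"
  shows "poly (f_poly q) x ^ q + w * poly (f_poly q) x = (x ^ q + w * x) ^ 97"
proof -
  have "poly (f_poly q) x ^ q = (x ^ 32) ^ 3 * x ^ q + (x ^ 32)\<^sup>2 * x * (x ^ q) ^ 32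
    + x ^ 32 * x * ((x ^ q) ^ 32)\<^sup>2
    + x ^ 32 * x ^ q * ((x ^ q) ^ 32)\<^sup>2 + x ^ q * ((x ^ q) ^ 32) ^ 3"
    unfolding poly_f_poly power_q_add power_mult_distrib power_q_power_commute[of _ 32]
      power_q_power_commute[of _ 2] power_q_power_commute[of _ 3] power_q_power_q ..
  thus ?thesis
    unfolding char_2_power_97[OF CHAR_eq_2 assms] poly_f_poly
    by (simp only: ac_simps)
qed

end

theorem theorem1p1:
  fixes m q :: nat
  assumes "m > 0"
    and "q = 2 ^ m"
    and "CARD('a) = q ^ 2"
  shows "permutation_polynomial (f_poly q :: 'a::finite_field poly) \<longleftrightarrow> \<not> [m = 0] (mod 24)"
proof -
  let ?f = "poly (f_poly q :: 'a poly)"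
  have card: "CARD('a) = 4 ^ m"
    using assms by (simp add: power2_eq_square flip: power_mult_distrib)
  have "[4 ^ m = 1 ^ m :: nat] (mod 3)"
    by (intro cong_pow) (simp add: cong_def)
  hence "3 dvd CARD('a) - 1"
    by (simp add: card cong_altdef_nat)
  then obtain w :: 'a where "w \<noteq> 1" and w3: "w ^ 3 = 1"
    using finite_field_ex_root_of_unity[of 3] by auto
  have "(w - 1) * (w\<^sup>2 + w + 1) = 0" using w3 by algebra
  with \<open>w \<noteq> 1\<close> have w: "w\<^sup>2 + w + 1 = 0" by simp
  \<comment> \<open>The square of \<open>w\<close> is the other primitive cube root of
    unity.\<close>
  have w': "(w\<^sup>2)\<^sup>2 + w\<^sup>2 + 1 = 0" using w by algebra
  have dvd: "97 dvd CARD('a) - 1 \<longleftrightarrow> [m = 0] (mod 24)"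
    unfolding card dvd_97_four_power_minus_1_iff cong_0_iff ..
  note L = linearized_f_poly[OF assms(2,3) w] and L' = linearized_f_poly[OF assms(2,3) w']
  have "inj ?f" if "\<not> [m = 0] (mod 24)"
  proof (rule injI)
    fix x z assume eq: "?f x = ?f z"
    have "coprime 97 (CARD('a) - 1)"
      using that dvd by (intro prime_imp_coprime) simp_all
    hence inj: "a = b" if "a ^ 97 = b ^ 97" for a b :: 'a
      using finite_field_inj_power[of 97, where 'a = 'a] that by (simp add: inj_def)
    have xz: "x ^ q + w * x = z ^ q + w * z" "x ^ q + w\<^sup>2 * x = z ^ q + w\<^sup>2 * z"
      by (rule inj, simp only: eq flip: L L')+
    \<comment> \<open>Subtracting the two linearized equations eliminates the \<open>q\<close>-th
      powers.\<close>
    have "(w\<^sup>2 - w) * (x - z) =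
        (x ^ q + w\<^sup>2 * x - (z ^ q + w\<^sup>2 * z)) - (x ^ q + w * x - (z ^ q + w * z))"
      by (simp add: algebra_simps)
    hence "(w\<^sup>2 - w) * (x - z) = 0" by (simp add: xz)
    moreover have "w\<^sup>2 - w \<noteq> 0"
    proof
      assume "w\<^sup>2 - w = 0"
      hence "w = w ^ 3" by algebra
      with w3 \<open>w \<noteq> 1\<close> show False by simp
    qed
    ultimately show "x = z" by simp
  qed
  moreover have "\<not> inj ?f" if m24: "[m = 0] (mod 24)"
  proof
    assume inj: "inj ?f"
    let ?L = "\<lambda>x::'a. x ^ q + w * x"
    obtain k where k: "m = 24 * k" using m24 unfolding cong_0_iff by (elim dvdE)
    \<comment> \<open>Here \<open>q = 4 ^ (12 * k)\<close>, so \<open>q\<close> is 1 modulo 3 and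
      \<open>w\<close> is fixed by the \<open>q\<close>-th power map.\<close>
    have "[2 ^ m = 1 :: nat] (mod 3)"
      using cong_pow[of "4 :: nat" 1 3 "12 * k"] by (simp add: k power_mult cong_def)
    then obtain j where "q - 1 = 3 * j"
      using assms(2) by (auto simp: cong_altdef_nat)
    moreover have "q > 0" using assms(2) by simp
    ultimately have "q = 3 * j + 1" by linarith
    hence wq: "w ^ q = w" by (simp add: power_add power_mult w3)
    have "inj ?L"
    proof (rule injI)
      fix x z assume eq: "?L x = ?L z"
      define d where "d = x - z"
      have x: "x = d + z" by (simp add: d_def)
      have "d ^ q = - (w * d)"
        using eq unfolding x power_q_add[OF assms(2,3)] by (simp add: algebra_simps eq_neg_iff_add_eq_0)
      also have "\<dots> = w * d"
        using uminus_CHAR_2[OF CHAR_eq_2[OF assms(2,3)]] .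
      finally have d: "d ^ q = w * d" .
      \<comment> \<open>Applying \<open>d ^ q = w * d\<close> twice multiplies a kernel element by
        \<open>w\<^sup>2\<close>, which differs from 1.\<close>
      have "d = (d ^ q) ^ q" by (simp add: power_q_power_q[OF assms(2,3)])
      also have "\<dots> = w\<^sup>2 * d"
        by (simp add: d power_mult_distrib wq power2_eq_square)
      finally have "(w\<^sup>2 - 1) * d = 0" by (simp add: algebra_simps)
      moreover have "w\<^sup>2 \<noteq> 1"
        using w3 \<open>w \<noteq> 1\<close> by (auto simp: power3_eq_cube power2_eq_square)
      ultimately show "x = z" by (simp add: d_def)
    qed
    hence "surj ?L" by (rule finite_UNIV_inj_surj[OF finite])
    obtain u :: 'a where u: "u \<noteq> 1" "u ^ 97 = 1"
      using finite_field_ex_root_of_unity[of 97] m24 dvd by auto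
    \<comment> \<open>As 1 and \<open>u\<close> have the same 97th power, their preimages under
      \<open>?L\<close> collide under \<open>?f\<close>.\<close>
    obtain x z where xz: "?L x = 1" "?L z = u"
      using surjD[OF \<open>surj ?L\<close>, of 1] surjD[OF \<open>surj ?L\<close>, of u] by metis
    have "?L (?f x) = ?L (?f z)"
      by (simp only: L xz u power_one)
    hence "?f x = ?f z" by (rule injD[OF \<open>inj ?L\<close>])
    hence "x = z" by (rule injD[OF inj])
    with xz u show False by simp
  qed
  moreover have "bij ?f \<longleftrightarrow> inj ?f"
    using finite_UNIV_inj_surj[OF finite, of ?f] by (auto simp: bij_def)
  ultimately show ?thesis
    unfolding permutation_polynomial_def by blast
qed

end
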